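(* Let $(\alpha,\beta)\in\mathbb{N}^2\setminus\{(0,0)\}$, let $(U^{CT}(t))_{t\ge0}$ be the continuous-time urn process started from $(\alpha,\beta)$, with successive jump times $0=\tau_0<\tau_1<\tau_2<\cdots$, and let $U^{DT}(n)=U^{CT}(\tau_n)$ for $n\ge 0$ (this is the discrete-time urn process built on the same probability space). Let $\xi=\lim_{t\to+\infty}e^{-St}u_1(U^{CT}(t))$, $W^{CT}=\lim_{t\to+\infty}e^{-mt}u_2(U^{CT}(t))$ and $W^{DT}=\lim_{n\to+\infty}n^{-\sigma}u_2(U^{DT}(n))$ (almost sure limits). Then $$W^{CT}=\xi^{\sigma}\,W^{DT}\qquad\text{almost surely},$$ and $\xi$ and $W^{DT}$ are independent.
   Context: Standing assumptions (balanced, large, nontriangular urn): $m,S,b$ are integers with $m+2\le S\le 2m-1$ and $1\le b\le S-m-1$; put $a=S-b$, $c=S-m-b$, $d=m+b$ and $\sigma=m/S\in(1/2,1)$. The replacement matrix is $R=\begin{pmatrix}a&b\\ c&d\end{pmatrix}$, with $a+b=c+d=S$ and eigenvalues $S$ and $m$. Continuous-time urn process: the Markov jump process on $\mathbb{N}^2\setminus\{(0,0)\}$ which, from a state $(x,y)$, jumps to $(x+a,y+b)$ at rate $x$ and to $(x+c,y+d)$ at rate $y$. Discrete-time urn process: the Markov chain on $\mathbb{N}^2\setminus\{(0,0)\}$ which moves from $(x,y)$ to $(x+a,y+b)$ with probability $\frac{x}{x+y}$ and to $(x+c,y+d)$ with probability $\frac{y}{x+y}$. Linear forms: $u_1(x,y)=\frac1S(x+y)$,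 $u_2(x,y)=\frac1S(bx-cy)$. All three limits in the statement exist almost surely for such urns. *)

theory Defs
  imports "HOL-Probability.Probability"
begin

text \<open>
  The path \<open>u\<close>, read on \<open>[0, \<infinity>)\<close>, is a right-continuous step function that jumps infinitely
  often, and \<open>0 = \<tau> 0 < \<tau> 1 < \<tau> 2 < \<dots>\<close> are its successive jump times.  Nothing is required of
  \<open>u\<close> after an accumulation point of the jump times, if there is one.
\<close>

definition jump_times :: "(real \<Rightarrow> 's) \<Rightarrow> (nat \<Rightarrow> real) \<Rightarrow> bool" where
  "jump_times u \<tau> \<longleftrightarrow>
     \<tau> 0 = 0 \<and>
     (\<forall>n. \<tau> n < \<tau> (Suc n) \<and>
          (\<forall>t\<in>{\<tau> n..<\<tau> (Suc n)}. u t = u (\<tau> n)) \<and>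
          u (\<tau> (Suc n)) \<noteq> u (\<tau> n))"

lemma jump_times_unique:
  assumes "jump_times u \<tau>" "jump_times u \<tau>'"
  shows "\<tau> = \<tau>'"
proof
  fix n
  show "\<tau> n = \<tau>' n"
  proof (induction n)
    case 0
    then show ?case using assms by (simp add: jump_times_def)
  next
    case (Suc n)
    have A: "\<tau> n < \<tau> (Suc n)" "\<And>t. \<tau> n \<le> t \<Longrightarrow> t < \<tau> (Suc n) \<Longrightarrow> u t = u (\<tau> n)"
      "u (\<tau> (Suc n)) \<noteq> u (\<tau> n)"
      using assms(1) unfolding jump_times_def by auto
    have B: "\<tau>' n < \<tau>' (Suc n)" "\<And>t. \<tau>' n \<le> t \<Longrightarrow> t < \<tau>' (Suc n) \<Longrightarrow> u t = u (\<tau>' n)"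
      "u (\<tau>' (Suc n)) \<noteq> u (\<tau>' n)"
      using assms(2) unfolding jump_times_def by auto
    show ?case
      using A(1,3) A(2)[of "\<tau>' (Suc n)"] B(1,3) B(2)[of "\<tau> (Suc n)"] Suc
      by (cases "\<tau> (Suc n)" "\<tau>' (Suc n)" rule: linorder_cases) auto
  qed
qed

definition exit_rate :: "('s \<Rightarrow> 's \<Rightarrow> real) \<Rightarrow> 's \<Rightarrow> real" where
  "exit_rate q s = (\<Sum>\<^sub>\<infinity>z. q s z)"

text \<open>
  Markov jump process on a countable state space without absorbing states, started from \<open>s0\<close>,
  which jumps from \<open>s\<close> to \<open>z\<close> at rate \<open>q s z\<close>.  Given the history up to the \<open>n\<close>-th jump, with
  present state \<open>s\<close>, the next jump is decided by the first of independent exponential clocks, the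
  clock of \<open>z\<close> having parameter \<open>q s z\<close>; hence it goes to \<open>z\<close> after a waiting time longer
  than \<open>r\<close> with conditional probability
  \<open>\<integral>\<^sub>r\<^sup>\<infinity> q s z * exp (- exit_rate q s * v) dv = q s z / exit_rate q s * exp (- exit_rate q s * r)\<close>.
  The events \<open>H\<close> below generate the history up to the \<open>n\<close>-th jump.
\<close>

definition markov_jump_process ::
  "'w measure \<Rightarrow> ('s::countable \<Rightarrow> 's \<Rightarrow> real) \<Rightarrow> 's \<Rightarrow> (real \<Rightarrow> 'w \<Rightarrow> 's) \<Rightarrow> bool" where
  "markov_jump_process M q s0 U \<longleftrightarrow>
     prob_space M \<and>
     (\<forall>t\<ge>0. U t \<in> measurable M (count_space UNIV)) \<and>
     (\<forall>\<omega>\<in>space M. U 0 \<omega> = s0) \<and>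
     (\<exists>\<tau>. (\<forall>n. \<tau> n \<in> borel_measurable M) \<and>
          (\<forall>\<omega>\<in>space M. jump_times (\<lambda>t. U t \<omega>) (\<lambda>n. \<tau> n \<omega>)) \<and>
          (\<forall>n (s :: nat \<Rightarrow> 's) (h :: nat \<Rightarrow> real) z. \<forall>r\<ge>0.
             let H = (\<lambda>\<omega>. (\<forall>k\<le>n. U (\<tau> k \<omega>) \<omega> = s k) \<and>
                          (\<forall>k<n. \<tau> (Suc k) \<omega> - \<tau> k \<omega> > h k))
             in \<P>(\<omega> in M. H \<omega> \<and> \<tau> (Suc n) \<omega> - \<tau> n \<omega> > r \<and> U (\<tau> (Suc n) \<omega>) \<omega> = z)
                = \<P>(\<omega> in M. H \<omega>) *
                  (q (s n) z / exit_rate q (s n) * exp (- exit_rate q (s n) * r))))"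

text \<open>
  Jump rates of the two-colour urn with replacement matrix \<open>(a, b; c, d)\<close>.  The state \<open>(0, 0)\<close> of
  the ambient type is never reached from any other state.
\<close>

definition urn_rate :: "nat \<Rightarrow> nat \<Rightarrow> nat \<Rightarrow> nat \<Rightarrow> nat \<times> nat \<Rightarrow> nat \<times> nat \<Rightarrow> real" where
  "urn_rate a b c d = (\<lambda>(x, y) z.
     (if z = (x + a, y + b) then real x else 0) +
     (if z = (x + c, y + d) then real y else 0))"

lemma exit_rate_urn: "exit_rate (urn_rate a b c d) (x, y) = real x + real y"
proof -
  let ?z = "(x + a, y + b)" and ?w = "(x + c, y + d)"
  have "exit_rate (urn_rate a b c d) (x, y) = (\<Sum>\<^sub>\<infinity>z\<in>{?z, ?w}. urn_rate a b c d (x, y) z)"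
    unfolding exit_rate_def by (rule infsum_cong_neutral) (auto simp: urn_rate_def)
  also have "\<dots> = (\<Sum>z\<in>{?z, ?w}. urn_rate a b c d (x, y) z)"
    by (rule infsum_finite) simp
  also have "\<dots> = real x + real y"
    unfolding urn_rate_def prod.case by (subst sum.distrib) (simp add: sum.delta)
  finally show ?thesis .
qed

definition u1 :: "nat \<Rightarrow> nat \<times> nat \<Rightarrow> real" where
  "u1 S = (\<lambda>(x, y). 1 / real S * (real x + real y))"

definition u2 :: "nat \<Rightarrow> nat \<Rightarrow> nat \<Rightarrow> nat \<times> nat \<Rightarrow> real" where
  "u2 S b c = (\<lambda>(x, y). 1 / real S * (real b * real x - real c * real y))"

end

theory Submission
  imports Defs
begin

text \<open>
  Every drawing adds exactly \<open>S\<close> balls, so after \<open>n\<close> jumps the urn contains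
  \<open>\<rho> n = \<alpha> + \<beta> + n * S\<close> balls, whatever colours were drawn.  Two consequences carry the proof.

  First, \<open>\<rho> n\<close> is also the total jump rate.  The waiting times between jumps are therefore independent
  exponential variables with the deterministic parameters \<open>\<rho> n\<close>, and they are independent of the
  sequence of visited states, that is, of the discrete-time urn
  (\<open>clocked_chain.indep_clocks_chain\<close>, \<open>clocked_chain_jump_process\<close>).  The limit \<open>W\<^sup>D\<^sup>T\<close> is a function of
  the discrete-time urn.  The limit \<open>\<xi>\<close> is a function of the waiting times: read at the jump time
  \<open>\<tau> n\<close>, where \<open>u1\<close> has the deterministic value \<open>\<rho> n / S\<close>, its defining limit becomes
  \<open>\<xi> = lim exp (- S * \<tau> n) * (\<rho> n / S)\<close>.  Hence \<open>\<xi>\<close> and \<open>W\<^sup>D\<^sup>T\<close> are independent.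

  Second, the last formula says \<open>exp (- S * \<tau> n) * n \<longrightarrow> \<xi>\<close>, so
  \<open>exp (- m * \<tau> n) = (exp (- S * \<tau> n)) powr \<sigma>\<close> is asymptotically equivalent to \<open>\<xi> powr \<sigma> * n powr (- \<sigma>)\<close> if
  \<open>\<xi> > 0\<close>.  Passing from one normalisation of \<open>u2\<close> along the jump times to the other multiplies the
  limit by \<open>\<xi> powr \<sigma>\<close>, also if \<open>\<xi> = 0\<close> (\<open>time_change_limit\<close>).

  Both arguments evaluate continuous-time limits along the jump times and so need \<open>\<tau> n \<longrightarrow> \<infinity>\<close>.
  This is proved by Laplace transforms: the expectation of \<open>exp (- S * \<tau> n)\<close> is the product of the
  \<open>\<rho> k / (\<rho> k + S) = \<rho> k / \<rho> (Suc k)\<close> over \<open>k < n\<close>, which telescopes to \<open>\<rho> 0 / \<rho> n\<close> and tends to 0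
  (\<open>clocked_chain.AE_clocks_diverge\<close>, \<open>urn_laplace_product\<close>).
\<close>

section \<open>Chains with independent exponential clocks\<close>

text \<open>
  \<open>V\<close> is the sequence of visited states and \<open>W n\<close> the waiting time in the state \<open>V n\<close>.  The product
  formula takes \<open>n\<close> clocks against \<open>n + 1\<close> states because this is the history up to the \<open>n\<close>-th
  jump.  Since \<open>n\<close> is arbitrary and the waiting times are positive, it determines the joint law of the
  two sequences given the law of \<open>V\<close>.
\<close>

locale clocked_chain = prob_space M
  for M :: "'w measure" +
  fixes V :: "nat \<Rightarrow> 'w \<Rightarrow> 's::countable" and W :: "nat \<Rightarrow> 'w \<Rightarrow> real" and \<rho> :: "nat \<Rightarrow> real"
  assumes V_measurable [measurable]: "\<And>n. V n \<in> measurable M (count_space UNIV)"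
    and W_measurable [measurable]: "\<And>n. W n \<in> borel_measurable M"
    and W_pos: "\<And>n \<omega>. \<omega> \<in> space M \<Longrightarrow> 0 < W n \<omega>"
    and \<rho>_pos: "\<And>n. 0 < \<rho> n"
    and prob_path_clocks: "\<And>n s h. (\<And>k. 0 \<le> h k) \<Longrightarrow>
      \<P>(\<omega> in M. (\<forall>k\<le>n. V k \<omega> = s k) \<and> (\<forall>k<n. h k < W k \<omega>)) =
      \<P>(\<omega> in M. \<forall>k\<le>n. V k \<omega> = s k) * (\<Prod>k<n. exp (- \<rho> k * h k))"
begin

definition path :: "nat \<Rightarrow> 'w \<Rightarrow> 's list" where
  "path n \<omega> = map (\<lambda>k. V k \<omega>) [0..<Suc n]"

lemma path_eq_iff: "path n \<omega> = l \<longleftrightarrow> length l = Suc n \<and> (\<forall>k\<le>n. V k \<omega> = l ! k)"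
  unfolding path_def list_eq_iff_nth_eq less_Suc_eq_le[symmetric]
  by (cases "length l = Suc n") (simp_all del: upt_Suc)

lemma take_path: "n \<le> n' \<Longrightarrow> take (Suc n) (path n' \<omega>) = path n \<omega>"
  unfolding path_def by (simp add: take_map del: upt_Suc)

lemma path_measurable [measurable]: "path n \<in> measurable M (count_space UNIV)"
proof (subst measurable_count_space_eq2_countable, safe)
  fix l
  have "path n -` {l} \<inter> space M = {\<omega> \<in> space M. length l = Suc n \<and> (\<forall>k\<le>n. V k \<omega> = l ! k)}"
    using path_eq_iff[of n _ l] by auto
  also have "\<dots> \<in> events" by measurable
  finally show "path n -` {l} \<inter> space M \<in> events" .
qed auto

definition clocks :: "nat \<Rightarrow> (nat \<Rightarrow> real) \<Rightarrow> 'w set" where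
  "clocks n h = {\<omega> \<in> space M. \<forall>k<n. h k < W k \<omega>}"

lemma clocks_measurable [measurable]: "clocks n h \<in> events"
  unfolding clocks_def by measurable

text \<open>
  There are only countably many paths, so the product formula for single paths extends to arbitrary
  sets of paths by comparing two measures on a countable space.
\<close>

lemma prob_path_in_clocks:
  assumes h: "\<And>k. 0 \<le> h k"
  shows "prob (path n -` L \<inter> space M \<inter> clocks n h) =
    prob (path n -` L \<inter> space M) * (\<Prod>k<n. exp (- \<rho> k * h k))"
proof -
  define c where "c = (\<Prod>k<n. exp (- \<rho> k * h k))"
  have c: "0 \<le> c" by (auto simp: c_def intro!: prod_nonneg)
  \<comment> \<open>\<open>?N1\<close> is the law of the path on the event that the clocks are large.\<close>
  let ?N1 = "distr (density M (indicator (clocks n h))) (count_space UNIV) (path n)"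
  let ?N2 = "scale_measure (ennreal c) (distr M (count_space UNIV) (path n))"
  have 1: "emeasure ?N1 L = emeasure M (path n -` L \<inter> space M \<inter> clocks n h)" for L
    by (subst emeasure_distr) (auto simp: emeasure_density Int_commute simp flip: indicator_inter_arith
        intro!: trans[OF nn_integral_cong nn_integral_indicator])
  have 2: "emeasure ?N2 L = ennreal c * emeasure M (path n -` L \<inter> space M)" for L
    by (simp add: emeasure_distr)
  have "?N1 = ?N2"
  proof (rule measure_eqI_countable[where A = UNIV])
    fix l :: "'s list"
    have "prob (path n -` {l} \<inter> space M \<inter> clocks n h) = c * prob (path n -` {l} \<inter> space M)"
    proof (cases "length l = Suc n")
      case True
      then have *: "path n -` {l} \<inter> space M = {\<omega> \<in> space M. \<forall>k\<le>n. V k \<omega> = l ! k}"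
        and **: "path n -` {l} \<inter> space M \<inter> clocks n h =
          {\<omega> \<in> space M. (\<forall>k\<le>n. V k \<omega> = l ! k) \<and> (\<forall>k<n. h k < W k \<omega>)}"
        using path_eq_iff[of n _ l] by (auto simp: clocks_def)
      show ?thesis unfolding ** unfolding * c_def by (subst prob_path_clocks[OF h]) simp
    next
      case False
      then have "path n -` {l} = {}" using path_eq_iff[of n _ l] by auto
      then show ?thesis by simp
    qed
    then show "emeasure ?N1 {l} = emeasure ?N2 {l}"
      using c by (simp only: 1 2 emeasure_eq_measure) (simp add: ennreal_mult)
  qed auto
  then have "emeasure M (path n -` L \<inter> space M \<inter> clocks n h) =
      ennreal c * emeasure M (path n -` L \<inter> space M)"
    using 1[of L] 2[of L] by simp
  then show ?thesis
    unfolding c_def[symmetric] using c by (simp add: emeasure_eq_measure mult.commute flip: ennreal_mult)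
qed

lemma prob_clocks:
  assumes "\<And>k. 0 \<le> h k"
  shows "prob (clocks n h) = (\<Prod>k<n. exp (- \<rho> k * h k))"
  using prob_path_in_clocks[of h n UNIV] assms sets.sets_into_space[OF clocks_measurable[of n h]]
  by (simp add: prob_space Int_absorb1)

text \<open>
  Waiting times are positive everywhere, not just almost surely.  A threshold \<open>0\<close> therefore imposes
  no condition, and events on clocks of different lengths can be brought to a common length.
\<close>

lemma clocks_extend:
  assumes "n \<le> n'"
  shows "clocks n h = clocks n' (\<lambda>k. if k < n then h k else 0)"
  using assms W_pos unfolding clocks_def by (auto split: if_splits)

lemma clocks_singleton:
  assumes "0 \<le> r" "k < n"
  shows "{\<omega> \<in> space M. r < W k \<omega>} = clocks n (\<lambda>j. if j = k then r else 0)"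
  using assms W_pos unfolding clocks_def by auto

lemma path_extend:
  assumes "n \<le> n'"
  shows "path n -` L \<inter> space M = path n' -` {l. take (Suc n) l \<in> L} \<inter> space M"
  using assms by (auto simp: take_path)

text \<open>The \<open>\<sigma>\<close>-algebra generated by the waiting times, given by a generator that is stable under
  intersections.\<close>

definition clock_algebra :: "'w measure" where
  "clock_algebra = sigma (space M) {clocks n h |n h. \<forall>k. 0 \<le> h k}"

text \<open>The \<open>\<sigma>\<close>-algebra generated by the visited states, again with an intersection-stable generator.\<close>

definition chain_algebra :: "'w measure" where
  "chain_algebra = sigma (space M) {path n -` L \<inter> space M |n L. True}"

lemma clock_generator_subset: "{clocks n h |n h. \<forall>k. 0 \<le> h k} \<subseteq> Pow (space M)"
  by (auto simp: clocks_def)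

lemma chain_generator_subset: "{path n -` L \<inter> space M |n L. True} \<subseteq> Pow (space M)"
  by auto

lemma space_clock_algebra [simp]: "space clock_algebra = space M"
  and space_chain_algebra [simp]: "space chain_algebra = space M"
  unfolding clock_algebra_def chain_algebra_def
  by (rule space_measure_of[OF clock_generator_subset] space_measure_of[OF chain_generator_subset])+

lemma sets_clock_algebra:
  "sets clock_algebra = sigma_sets (space M) {clocks n h |n h. \<forall>k. 0 \<le> h k}"
  unfolding clock_algebra_def by (rule sets_measure_of[OF clock_generator_subset])

lemma sets_chain_algebra:
  "sets chain_algebra = sigma_sets (space M) {path n -` L \<inter> space M |n L. True}"
  unfolding chain_algebra_def by (rule sets_measure_of[OF chain_generator_subset])

lemma clock_measurable_clock_algebra [measurable]: "W k \<in> borel_measurable clock_algebra"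
proof -
  have "{\<omega> \<in> space M. r < W k \<omega>} \<in> sets clock_algebra" for r
  proof -
    have "{\<omega> \<in> space M. r < W k \<omega>} = {\<omega> \<in> space M. max 0 r < W k \<omega>}"
      using W_pos by auto
    also have "\<dots> = clocks (Suc k) (\<lambda>j. if j = k then max 0 r else 0)"
      by (rule clocks_singleton) auto
    also have "\<dots> \<in> sets clock_algebra"
      unfolding sets_clock_algebra by (intro sigma_sets.Basic CollectI exI conjI) auto
    finally show ?thesis .
  qed
  then show ?thesis
    by (simp add: borel_measurable_iff_greater)
qed

lemma chain_measurable_chain_algebra [measurable]: "V k \<in> measurable chain_algebra (count_space UNIV)"
proof -
  have "V k -` X \<inter> space M \<in> sets chain_algebra" for X
  proof -
    have "V k -` X \<inter> space M = path k -` {l. l ! k \<in> X} \<inter> space M"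
      by (auto simp: path_def simp del: upt_Suc)
    also have "\<dots> \<in> sets chain_algebra"
      unfolding sets_chain_algebra by (intro sigma_sets.Basic) blast
    finally show ?thesis .
  qed
  then show ?thesis by (simp add: measurable_def)
qed

lemma indep_generators:
  "indep_set {clocks n h |n h. \<forall>k. 0 \<le> h k} {path n -` L \<inter> space M |n L. True}"
proof (rule indep_setI)
  fix A B assume "A \<in> {clocks n h |n h. \<forall>k. 0 \<le> h k}" and "B \<in> {path n -` L \<inter> space M |n L. True}"
  then obtain n h n' L where h: "\<And>k. 0 \<le> h k" and A: "A = clocks n h"
    and B: "B = path n' -` L \<inter> space M" by blast
  define N where "N = max n n'"
  have A': "A = clocks N (\<lambda>k. if k < n then h k else 0)"
    unfolding A by (rule clocks_extend) (simp add: N_def)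
  have B': "B = path N -` {l. take (Suc n') l \<in> L} \<inter> space M"
    unfolding B by (rule path_extend) (simp add: N_def)
  have h': "\<And>k. 0 \<le> (if k < n then h k else 0)" using h by simp
  show "prob (A \<inter> B) = prob A * prob B"
    unfolding A' B'
    by (simp only: Int_commute[of "clocks _ _"] prob_path_in_clocks[OF h'] prob_clocks[OF h'] mult.commute)
qed auto

lemma Int_stable_clocks: "Int_stable {clocks n h |n h. \<forall>k. 0 \<le> h k}"
proof (rule Int_stableI, clarify)
  fix n n' :: nat and h h' :: "nat \<Rightarrow> real" assume h: "\<forall>k. 0 \<le> h k" "\<forall>k. 0 \<le> h' k"
  let ?h = "\<lambda>k. max (if k < n then h k else 0) (if k < n' then h' k else 0)"
  have "clocks N f \<inter> clocks N g = clocks N (\<lambda>k. max (f k) (g k))" for N f g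
    by (auto simp: clocks_def)
  from this[of "max n n'" "\<lambda>k. if k < n then h k else 0" "\<lambda>k. if k < n' then h' k else 0"]
  have "clocks n h \<inter> clocks n' h' = clocks (max n n') ?h"
    by (simp only: clocks_extend[OF max.cobounded1, symmetric] clocks_extend[OF max.cobounded2, symmetric])
  then show "\<exists>N g. clocks n h \<inter> clocks n' h' = clocks N g \<and> (\<forall>k. 0 \<le> g k)"
    using h by (intro exI[of _ "max n n'"] exI[of _ ?h]) (auto simp: le_max_iff_disj)
qed

lemma Int_stable_path: "Int_stable {path n -` L \<inter> space M |n L. True}"
proof (rule Int_stableI, clarify)
  fix n n' :: nat and L L' :: "'s list set"
  have "(path n -` L \<inter> space M) \<inter> (path n' -` L' \<inter> space M) = path (max n n') -`
      ({l. take (Suc n) l \<in> L} \<inter> {l. take (Suc n') l \<in> L'}) \<inter> space M"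
    using path_extend[of n "max n n'" L] path_extend[of n' "max n n'" L'] by auto
  then show "\<exists>N K. (path n -` L \<inter> space M) \<inter> (path n' -` L' \<inter> space M) = path N -` K \<inter> space M \<and> True"
    by blast
qed

text \<open>
  Independence holds on the two intersection-stable generators by the product formula, hence on the
  generated \<open>\<sigma>\<close>-algebras.  It is stated for measurable maps on them, rather than for the two
  sequences as random variables, because limits along the sequences are then covered directly.
\<close>

theorem indep_clocks_chain:
  assumes X: "X \<in> measurable clock_algebra S" and Y: "Y \<in> measurable chain_algebra T"
  shows "indep_var S X T Y"
proof -
  have indep: "indep_set (sets clock_algebra) (sets chain_algebra)"
    unfolding sets_clock_algebra sets_chain_algebra
    by (intro indep_set_sigma_sets indep_generators Int_stable_clocks Int_stable_path)
  have pull: "sigma_sets (space M) {Z -` A \<inter> space M |A. A \<in> sets N} \<subseteq> sets F"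
    if Z: "Z \<in> measurable F N" and F: "space F = space M" for Z F and N :: "'c measure"
    using measurable_sets[OF Z] unfolding F[symmetric] by (intro sets.sigma_sets_subset) auto
  have "sets clock_algebra \<subseteq> events" "sets chain_algebra \<subseteq> events"
    using indep unfolding indep_sets2_eq by auto
  then have "random_variable S X" "random_variable T Y"
    using X Y by (auto simp: measurable_def)
  moreover have "indep_set (sigma_sets (space M) {X -` A \<inter> space M |A. A \<in> sets S})
       (sigma_sets (space M) {Y -` A \<inter> space M |A. A \<in> sets T})"
    unfolding indep_sets2_eq
  proof (intro conjI ballI)
    note X' = pull[OF X space_clock_algebra] and Y' = pull[OF Y space_chain_algebra]
    show "sigma_sets (space M) {X -` A \<inter> space M |A. A \<in> sets S} \<subseteq> events"
      and "sigma_sets (space M) {Y -` A \<inter> space M |A. A \<in> sets T} \<subseteq> events"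
      using X' Y' indep unfolding indep_sets2_eq by (meson order_trans)+
    fix A B assume "A \<in> sigma_sets (space M) {X -` A \<inter> space M |A. A \<in> sets S}"
      and "B \<in> sigma_sets (space M) {Y -` A \<inter> space M |A. A \<in> sets T}"
    then have "A \<in> sets clock_algebra" "B \<in> sets chain_algebra"
      using X' Y' by (blast dest: subsetD)+
    then show "prob (A \<inter> B) = prob A * prob B"
      using indep unfolding indep_sets2_eq by (meson bspec)
  qed
  ultimately show ?thesis unfolding indep_var_eq by blast
qed

lemma prob_clock:
  assumes "0 \<le> r"
  shows "\<P>(\<omega> in M. r < W k \<omega>) = exp (- \<rho> k * r)"
proof -
  have "\<P>(\<omega> in M. r < W k \<omega>) = (\<Prod>j<Suc k. exp (- \<rho> j * (if j = k then r else 0)))"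
    unfolding clocks_singleton[OF assms lessI] by (rule prob_clocks) (use assms in simp)
  also have "\<dots> = exp (- \<rho> k * r)" by simp
  finally show ?thesis .
qed

lemma clock_exponential: "distributed M lborel (W k) (exponential_density (\<rho> k))"
proof (subst exponential_distributed_iff[OF \<rho>_pos], intro conjI allI impI)
  fix r :: real assume "0 \<le> r"
  have "\<P>(\<omega> in M. W k \<omega> \<le> r) = 1 - \<P>(\<omega> in M. r < W k \<omega>)"
    by (subst prob_neg[symmetric]) (auto simp: not_less)
  with \<open>0 \<le> r\<close> show "\<P>(\<omega> in M. W k \<omega> \<le> r) = 1 - exp (- r * \<rho> k)"
    by (simp add: prob_clock mult.commute)
qed simp

text \<open>
  The waiting times are also independent among themselves: the half-lines together with \<open>UNIV\<close>
  generate the Borel sets, and on them the required identity is \<open>prob_clocks\<close>.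
\<close>

lemma indep_clocks: "indep_vars (\<lambda>_. borel) W {..<n}"
proof (cases "n = 0")
  case True
  then show ?thesis by (simp add: indep_vars_def indep_sets_def)
next
  case False
  \<comment> \<open>The finite criterion for independence requires the whole space to be in the generator.\<close>
  let ?E = "insert UNIV (range greaterThan) :: real set set"
  have "{x<..} \<inter> {y<..} = {max x y<..}" for x y :: real by auto
  then have "Int_stable ?E" unfolding Int_stable_def by auto
  moreover have "sets borel = sigma_sets UNIV ?E"
  proof -
    have "sigma_sets UNIV ?E = sigma_sets UNIV (range greaterThan)"
      by (rule sigma_sets_eqI) (auto intro: sigma_sets_top)
    then show ?thesis by (subst borel_Ioi) (simp add: sets_measure_of)
  qed
  moreover have "prob (\<Inter>j\<in>{..<n}. W j -` A j \<inter> space M) = (\<Prod>j<n. prob (W j -` A j \<inter> space M))"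
    if A: "A \<in> (\<Pi> i\<in>{..<n}. ?E)" for A
  proof -
    have "\<exists>r\<ge>0. W j -` A j \<inter> space M = {\<omega> \<in> space M. r < W j \<omega>}" if "j < n" for j
    proof -
      from A that consider "A j = UNIV" | r where "A j = {r<..}" by blast
      then show ?thesis
      proof cases
        case 1
        then show ?thesis using W_pos by (intro exI[of _ 0]) auto
      next
        case (2 r)
        then show ?thesis using W_pos by (intro exI[of _ "max 0 r"]) auto
      qed
    qed
    then obtain g where g: "\<And>j. j < n \<Longrightarrow> 0 \<le> g j"
      "\<And>j. j < n \<Longrightarrow> W j -` A j \<inter> space M = {\<omega> \<in> space M. g j < W j \<omega>}"
      by metis
    define h where "h j = (if j < n then g j else 0)" for j
    have h: "0 \<le> h j" for j by (simp add: h_def g)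
    have "(\<Inter>j\<in>{..<n}. W j -` A j \<inter> space M) = clocks n h"
      using False g(2) by (auto simp: clocks_def h_def)
    moreover have "prob (W j -` A j \<inter> space M) = exp (- \<rho> j * h j)" if "j < n" for j
      using that h[of j] prob_clock[of "h j" j] by (simp add: g(2) h_def)
    ultimately show ?thesis by (simp add: prob_clocks[OF h])
  qed
  ultimately show ?thesis
    by (subst indep_vars_finite[where E = "\<lambda>_. ?E"]) (use False in auto)
qed

text \<open>
  Multiplying the exponential density of parameter \<open>\<rho> k\<close> by \<open>exp (- s * x)\<close> gives the exponential
  density of parameter \<open>\<rho> k + s\<close> up to the factor \<open>\<rho> k / (\<rho> k + s)\<close>.
\<close>

lemma clock_laplace:
  assumes "0 < s"
  shows "(\<integral>\<^sup>+\<omega>. ennreal (exp (- s * W k \<omega>)) \<partial>M) = ennreal (\<rho> k / (\<rho> k + s))"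
proof -
  have pos: "0 < \<rho> k" "0 < \<rho> k + s" using \<rho>_pos[of k] assms by auto
  interpret E: prob_space "density lborel (exponential_density (\<rho> k + s))"
    by (rule prob_space_exponential_density) fact
  have one: "(\<integral>\<^sup>+x. ennreal (exponential_density (\<rho> k + s) x) \<partial>lborel) = 1"
    using E.emeasure_space_1 by (simp add: emeasure_density)
  have "(\<integral>\<^sup>+\<omega>. ennreal (exp (- s * W k \<omega>)) \<partial>M) =
      (\<integral>\<^sup>+x. ennreal (exponential_density (\<rho> k) x) * ennreal (exp (- s * x)) \<partial>lborel)"
    by (rule distributed_nn_integral[OF clock_exponential, symmetric]) simp
  also have "\<dots> = (\<integral>\<^sup>+x. ennreal (\<rho> k / (\<rho> k + s)) * ennreal (exponential_density (\<rho> k + s) x) \<partial>lborel)"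
  proof (intro nn_integral_cong)
    fix x :: real
    have "exp (- x * \<rho> k) * exp (- s * x) = exp (- x * (\<rho> k + s))"
      by (simp add: exp_add[symmetric] algebra_simps)
    then have "exponential_density (\<rho> k) x * exp (- s * x) =
        \<rho> k / (\<rho> k + s) * exponential_density (\<rho> k + s) x"
      using pos by (simp add: exponential_density_def mult.assoc)
    then show "ennreal (exponential_density (\<rho> k) x) * ennreal (exp (- s * x)) =
        ennreal (\<rho> k / (\<rho> k + s)) * ennreal (exponential_density (\<rho> k + s) x)"
      using pos by (simp add: exponential_density_nonneg flip: ennreal_mult)
  qed
  also have "\<dots> = ennreal (\<rho> k / (\<rho> k + s))"
    by (subst nn_integral_cmult) (auto simp: one)
  finally show ?thesis .
qed

text \<open>
  By independence the product in the hypothesis is the expectation of \<open>Z n = exp (- s * T n)\<close>, where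
  \<open>T n\<close> is the sum of the first \<open>n\<close> waiting times.  So the infimum of the \<open>Z n\<close> has expectation 0 and
  vanishes almost surely, which means that \<open>T\<close> is unbounded; being increasing, it tends to infinity.
\<close>

lemma AE_clocks_diverge:
  assumes s: "0 < s" and lim: "(\<lambda>n. \<Prod>k<n. \<rho> k / (\<rho> k + s)) \<longlonglongrightarrow> 0"
  shows "AE \<omega> in M. filterlim (\<lambda>n. \<Sum>k<n. W k \<omega>) at_top sequentially"
proof -
  let ?Z = "\<lambda>n \<omega>. ennreal (exp (- s * (\<Sum>k<n. W k \<omega>)))"
  have Z: "(\<integral>\<^sup>+\<omega>. ?Z n \<omega> \<partial>M) = ennreal (\<Prod>k<n. \<rho> k / (\<rho> k + s))" for n
  proof -
    have "(\<integral>\<^sup>+\<omega>. ?Z n \<omega> \<partial>M) = (\<integral>\<^sup>+\<omega>. (\<Prod>k<n. ennreal (exp (- s * W k \<omega>))) \<partial>M)"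
      by (simp add: sum_distrib_left exp_sum prod_ennreal flip: sum_negf)
    also have "\<dots> = (\<Prod>k<n. \<integral>\<^sup>+\<omega>. ennreal (exp (- s * W k \<omega>)) \<partial>M)"
      using indep_vars_compose2[OF indep_clocks, of n "\<lambda>_ x. ennreal (exp (- s * x))" "\<lambda>_. borel"]
      by (intro indep_vars_nn_integral) auto
    also have "\<dots> = ennreal (\<Prod>k<n. \<rho> k / (\<rho> k + s))"
      unfolding clock_laplace[OF s] using \<rho>_pos s by (intro prod_ennreal) (simp add: add_pos_pos less_imp_le)
    finally show ?thesis .
  qed
  have "(\<integral>\<^sup>+\<omega>. (INF n. ?Z n \<omega>) \<partial>M) \<le> ennreal (\<Prod>k<n. \<rho> k / (\<rho> k + s))" for n
    unfolding Z[symmetric] by (intro nn_integral_mono INF_lower) auto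
  then have "(\<integral>\<^sup>+\<omega>. (INF n. ?Z n \<omega>) \<partial>M) \<le> ennreal 0"
    by (intro LIMSEQ_le_const[OF tendsto_ennrealI[OF lim]]) auto
  then have "AE \<omega> in M. (INF n. ?Z n \<omega>) = 0"
    by (subst (asm) ennreal_0) (simp add: nn_integral_0_iff_AE)
  with AE_space show ?thesis
  proof eventually_elim
    case (elim \<omega>)
    have unbounded: "\<exists>n. K < (\<Sum>k<n. W k \<omega>)" for K
    proof (rule ccontr)
      assume "\<not> ?thesis"
      then have "ennreal (exp (- s * K)) \<le> (INF n. ?Z n \<omega>)"
        using s by (intro INF_greatest ennreal_leI) (auto simp: not_less)
      then show False using elim by simp
    qed
    have mono: "(\<Sum>k<n. W k \<omega>) \<le> (\<Sum>k<n'. W k \<omega>)" if "n \<le> n'" for n n'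
      using that W_pos[OF elim(1)] by (intro sum_mono2) (auto intro: less_imp_le)
    show ?case
      unfolding filterlim_at_top eventually_sequentially
      using unbounded mono by (meson less_imp_le order_trans)
  qed
qed

end

lemma (in prob_space) indep_var_cong_AE:
  assumes "indep_var S X T Y" and "AE \<omega> in M. X \<omega> = X' \<omega>" and "AE \<omega> in M. Y \<omega> = Y' \<omega>"
    and [measurable]: "X' \<in> measurable M S" "Y' \<in> measurable M T"
  shows "indep_var S X' T Y'"
proof -
  have [measurable]: "X \<in> measurable M S" "Y \<in> measurable M T"
    using assms(1) by (auto dest: indep_var_rv1 indep_var_rv2)
  have "distr M S X' = distr M S X" "distr M T Y' = distr M T Y"
    using assms(2,3) by (auto intro!: distr_cong_AE)
  moreover have "distr M (S \<Otimes>\<^sub>M T) (\<lambda>\<omega>. (X' \<omega>, Y' \<omega>)) = distr M (S \<Otimes>\<^sub>M T) (\<lambda>\<omega>. (X \<omega>, Y \<omega>))"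
    using assms(2,3) by (intro distr_cong_AE) auto
  ultimately show ?thesis
    using assms(1) by (simp add: indep_var_distribution_eq)
qed

section \<open>Jump processes whose exit rates depend only on the number of jumps\<close>

lemma jump_times_nonneg:
  assumes "jump_times u \<tau>"
  shows "0 \<le> \<tau> n"
proof (induction n)
  case (Suc n)
  moreover have "\<tau> n < \<tau> (Suc n)" using assms by (simp add: jump_times_def)
  ultimately show ?case by linarith
qed (use assms in \<open>simp add: jump_times_def\<close>)

text \<open>
  A path is constant between jumps, so the state at a jump time is the state at any rational time
  before the next jump.  This exhibits the event as a countable union of events at fixed times.
\<close>

lemma embedded_state_measurable:
  fixes U :: "real \<Rightarrow> 'w \<Rightarrow> 's::countable"
  assumes U: "\<And>t. 0 \<le> t \<Longrightarrow> U t \<in> measurable M (count_space UNIV)"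
    and \<tau> [measurable]: "\<And>n. \<tau> n \<in> borel_measurable M"
    and jumps: "\<And>\<omega>. \<omega> \<in> space M \<Longrightarrow> jump_times (\<lambda>t. U t \<omega>) (\<lambda>n. \<tau> n \<omega>)"
  shows "(\<lambda>\<omega>. U (\<tau> n \<omega>) \<omega>) \<in> measurable M (count_space UNIV)"
proof (subst measurable_count_space_eq2_countable, safe)
  fix s
  let ?R = "\<lambda>r. {\<omega> \<in> space M. \<tau> n \<omega> \<le> r \<and> r < \<tau> (Suc n) \<omega> \<and> U r \<omega> = s}"
  have "(\<lambda>\<omega>. U (\<tau> n \<omega>) \<omega>) -` {s} \<inter> space M = (\<Union>r\<in>\<rat> \<inter> {0..}. ?R r)"
  proof safe
    fix \<omega> assume \<omega>: "\<omega> \<in> space M" and s: "s = U (\<tau> n \<omega>) \<omega>"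
    have "\<tau> n \<omega> < \<tau> (Suc n) \<omega>"
      using jumps[OF \<omega>] by (simp add: jump_times_def)
    then obtain r where r: "r \<in> \<rat>" "\<tau> n \<omega> < r" "r < \<tau> (Suc n) \<omega>"
      using Rats_dense_in_real by blast
    then have "U r \<omega> = s" "0 \<le> r"
      using jumps[OF \<omega>] jump_times_nonneg[OF jumps[OF \<omega>], of n] s by (auto simp: jump_times_def)
    with r \<omega> s show "\<omega> \<in> (\<Union>r\<in>\<rat> \<inter> {0..}. {\<omega>' \<in> space M. \<tau> n \<omega>' \<le> r \<and> r < \<tau> (Suc n) \<omega>' \<and> U r \<omega>' = U (\<tau> n \<omega>) \<omega>})"
      by (intro UN_I[of r]) auto
  qed (use jumps in \<open>auto simp: jump_times_def\<close>)
  also have "\<dots> \<in> sets M"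
  proof (rule sets.countable_UN'')
    show "countable (\<rat> \<inter> {0..} :: real set)"
      by (rule countable_Int1[OF countable_rat])
    fix r :: real assume "r \<in> \<rat> \<inter> {0..}"
    then have [measurable]: "U r \<in> measurable M (count_space UNIV)" using U by auto
    show "?R r \<in> sets M" by measurable
  qed
  finally show "(\<lambda>\<omega>. U (\<tau> n \<omega>) \<omega>) -` {s} \<inter> space M \<in> sets M" .
qed auto

text \<open>
  The Markov property gives the probability of a history as a product along the path, in which the
  waiting time in the \<open>k\<close>-th state \<open>s k\<close> contributes \<open>exp (- exit_rate q (s k) * h k)\<close>.  On paths of positive
  probability the exit rate of \<open>s k\<close> is \<open>\<rho> k\<close>, so this factor does not depend on the path.  On paths of
  probability zero both sides of the product formula vanish.
\<close>

lemma
  fixes M :: "'w measure" and U :: "real \<Rightarrow> 'w \<Rightarrow> 's::countable"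
    and \<tau> :: "nat \<Rightarrow> 'w \<Rightarrow> real" and \<rho> :: "nat \<Rightarrow> real"
  assumes process: "markov_jump_process M q s0 U"
    and jumps: "\<And>\<omega>. \<omega> \<in> space M \<Longrightarrow> jump_times (\<lambda>t. U t \<omega>) (\<lambda>n. \<tau> n \<omega>)"
    and \<rho>_pos: "\<And>n. 0 < \<rho> n"
    and rate_0: "exit_rate q s0 = \<rho> 0"
    and rate_Suc: "\<And>n s z. exit_rate q s = \<rho> n \<Longrightarrow> q s z \<noteq> 0 \<Longrightarrow> exit_rate q z = \<rho> (Suc n)"
  shows clocked_chain_jump_process:
      "clocked_chain M (\<lambda>n \<omega>. U (\<tau> n \<omega>) \<omega>) (\<lambda>n \<omega>. \<tau> (Suc n) \<omega> - \<tau> n \<omega>) \<rho>"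
    and AE_exit_rate_jump_process: "AE \<omega> in M. exit_rate q (U (\<tau> n \<omega>) \<omega>) = \<rho> n"
proof -
  interpret prob_space M using process by (simp add: markov_jump_process_def)
  define V where "V n \<omega> = U (\<tau> n \<omega>) \<omega>" for n \<omega>
  define W where "W n \<omega> = \<tau> (Suc n) \<omega> - \<tau> n \<omega>" for n \<omega>
  \<comment> \<open>\<open>C n s h\<close> is the probability of a history; \<open>h = 0\<close> gives the probability of the path alone.\<close>
  define C where "C n s h = \<P>(\<omega> in M. (\<forall>k\<le>n. V k \<omega> = s k) \<and> (\<forall>k<n. h k < W k \<omega>))" for n s h
  obtain \<tau>' where \<tau>': "\<And>n. \<tau>' n \<in> borel_measurable M"
    and jumps': "\<And>\<omega>. \<omega> \<in> space M \<Longrightarrow> jump_times (\<lambda>t. U t \<omega>) (\<lambda>n. \<tau>' n \<omega>)"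
    and markov': "\<And>n s h z r. 0 \<le> r \<Longrightarrow>
      \<P>(\<omega> in M. ((\<forall>k\<le>n. U (\<tau>' k \<omega>) \<omega> = s k) \<and> (\<forall>k<n. \<tau>' (Suc k) \<omega> - \<tau>' k \<omega> > h k)) \<and>
        \<tau>' (Suc n) \<omega> - \<tau>' n \<omega> > r \<and> U (\<tau>' (Suc n) \<omega>) \<omega> = z) =
      \<P>(\<omega> in M. (\<forall>k\<le>n. U (\<tau>' k \<omega>) \<omega> = s k) \<and> (\<forall>k<n. \<tau>' (Suc k) \<omega> - \<tau>' k \<omega> > h k)) *
        (q (s n) z / exit_rate q (s n) * exp (- exit_rate q (s n) * r))"
    using process unfolding markov_jump_process_def Let_def by blast
  \<comment> \<open>The jump times of the definition are the given ones, by uniqueness.\<close>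
  have eq: "\<tau>' k \<omega> = \<tau> k \<omega>" if "\<omega> \<in> space M" for k \<omega>
    using jump_times_unique[OF jumps'[OF that] jumps[OF that]] by (rule fun_cong)
  have \<tau> [measurable]: "\<tau> n \<in> borel_measurable M" for n
    using \<tau>' eq by (subst measurable_cong[of M "\<tau> n" "\<tau>' n"]) auto
  have U: "U t \<in> measurable M (count_space UNIV)" if "0 \<le> t" for t
    using process that by (simp add: markov_jump_process_def)
  have [measurable]: "V n \<in> measurable M (count_space UNIV)" for n
    unfolding V_def by (rule embedded_state_measurable[OF U \<tau> jumps])
  have [measurable]: "W n \<in> borel_measurable M" for n
    unfolding W_def by measurable
  have W_pos: "0 < W n \<omega>" if "\<omega> \<in> space M" for n \<omega>
    using jumps[OF that] by (simp add: W_def jump_times_def)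
  have V_0: "V 0 \<omega> = s0" if "\<omega> \<in> space M" for \<omega>
    using jumps[OF that] process that by (simp add: V_def jump_times_def markov_jump_process_def)
  have markov: "C (Suc n) s h = C n s h * (q (s n) (s (Suc n)) / exit_rate q (s n) *
      exp (- exit_rate q (s n) * h n))" if h: "0 \<le> h n" for n s h
  proof -
    have "C (Suc n) s h = \<P>(\<omega> in M. ((\<forall>k\<le>n. U (\<tau>' k \<omega>) \<omega> = s k) \<and> (\<forall>k<n. \<tau>' (Suc k) \<omega> - \<tau>' k \<omega> > h k)) \<and>
        \<tau>' (Suc n) \<omega> - \<tau>' n \<omega> > h n \<and> U (\<tau>' (Suc n) \<omega>) \<omega> = s (Suc n))"
      unfolding C_def by (intro arg_cong[where f = prob] Collect_cong)
        (auto simp: eq V_def W_def le_Suc_eq less_Suc_eq)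
    also have "\<dots> = \<P>(\<omega> in M. (\<forall>k\<le>n. U (\<tau>' k \<omega>) \<omega> = s k) \<and> (\<forall>k<n. \<tau>' (Suc k) \<omega> - \<tau>' k \<omega> > h k)) *
        (q (s n) (s (Suc n)) / exit_rate q (s n) * exp (- exit_rate q (s n) * h n))"
      by (rule markov'[OF h])
    also have "\<P>(\<omega> in M. (\<forall>k\<le>n. U (\<tau>' k \<omega>) \<omega> = s k) \<and> (\<forall>k<n. \<tau>' (Suc k) \<omega> - \<tau>' k \<omega> > h k)) = C n s h"
      unfolding C_def by (intro arg_cong[where f = prob] Collect_cong) (auto simp: eq V_def W_def)
    finally show ?thesis .
  qed
  have C_0: "C n s (\<lambda>_. 0) = \<P>(\<omega> in M. \<forall>k\<le>n. V k \<omega> = s k)" for n s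
    unfolding C_def using W_pos by (intro arg_cong[where f = prob] Collect_cong) auto
  have rate: "exit_rate q (s n) = \<rho> n" if "C n s (\<lambda>_. 0) \<noteq> 0" for n s
    using that
  proof (induction n)
    case 0
    have "s 0 = s0"
    proof (rule ccontr)
      assume "s 0 \<noteq> s0"
      then have "{\<omega> \<in> space M. \<forall>k\<le>0. V k \<omega> = s k} = {}" using V_0 by auto
      with 0 show False unfolding C_0 by (simp only: measure_empty)
    qed
    then show ?case by (simp add: rate_0)
  next
    case (Suc n)
    then have "C n s (\<lambda>_. 0) \<noteq> 0" "q (s n) (s (Suc n)) \<noteq> 0"
      by (auto simp: markov)
    with Suc.IH rate_Suc show ?case by blast
  qed
  have "C n s h = C n s (\<lambda>_. 0) * (\<Prod>k<n. exp (- \<rho> k * h k))" if h: "\<And>k. 0 \<le> h k" for n s h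
  proof (induction n)
    case 0
    then show ?case by (simp add: C_def)
  next
    case (Suc n)
    then show ?case
      using rate[of n s] h[of n] by (cases "C n s (\<lambda>_. 0) = 0") (simp_all add: markov)
  qed
  then show "clocked_chain M (\<lambda>n \<omega>. U (\<tau> n \<omega>) \<omega>) (\<lambda>n \<omega>. \<tau> (Suc n) \<omega> - \<tau> n \<omega>) \<rho>"
    unfolding V_def[symmetric] W_def[symmetric] using W_pos \<rho>_pos
    by unfold_locales (auto simp: C_def C_0[unfolded C_def])
  show "AE \<omega> in M. exit_rate q (U (\<tau> n \<omega>) \<omega>) = \<rho> n"
  proof -
    have "AE \<omega> in M. map (\<lambda>k. V k \<omega>) [0..<Suc n] = l \<longrightarrow> exit_rate q (l ! n) = \<rho> n" for l
    proof (cases "C n (\<lambda>k. l ! k) (\<lambda>_. 0) = 0")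
      case True
      then have "AE \<omega> in M. \<not> (\<forall>k\<le>n. V k \<omega> = l ! k)"
        unfolding C_0 by (subst (asm) prob_eq_0) auto
      then show ?thesis
        by eventually_elim (auto simp del: upt_Suc)
    next
      case False
      then show ?thesis using rate[of n "\<lambda>k. l ! k"] by simp
    qed
    then have "AE \<omega> in M. \<forall>l. map (\<lambda>k. V k \<omega>) [0..<Suc n] = l \<longrightarrow> exit_rate q (l ! n) = \<rho> n"
      by (subst AE_all_countable) blast
    then show ?thesis
      by eventually_elim (simp add: V_def del: upt_Suc)
  qed
qed

section \<open>Changing from the jump times to the number of jumps\<close>

text \<open>
  As \<open>\<tau> n \<longrightarrow> \<infinity>\<close>, the shift \<open>r\<close> is negligible and \<open>exp (- S * \<tau> n) * n \<longrightarrow> x\<close>.  The power \<open>m / S\<close> of this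
  sequence is the ratio of the two normalisations of \<open>v\<close>.  The exponent is positive, so powers
  converge even if \<open>x = 0\<close>.
\<close>

lemma time_change_limit:
  fixes \<tau> v :: "nat \<Rightarrow> real" and S m r x wC wD :: real
  assumes \<tau>: "filterlim \<tau> at_top sequentially" and "0 < S" and "0 < m"
    and size: "(\<lambda>n. exp (- S * \<tau> n) * (real n + r)) \<longlonglongrightarrow> x"
    and wC: "(\<lambda>n. exp (- m * \<tau> n) * v n) \<longlonglongrightarrow> wC"
    and wD: "(\<lambda>n. real n powr (- (m / S)) * v n) \<longlonglongrightarrow> wD"
  shows "wC = x powr (m / S) * wD"
proof (rule LIMSEQ_unique[OF wC])
  have "filterlim (\<lambda>n. - S * \<tau> n) at_bot sequentially"
    using \<tau> \<open>0 < S\<close> by (intro filterlim_tendsto_neg_mult_at_bot[OF tendsto_const]) auto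
  then have "(\<lambda>n. exp (- S * \<tau> n)) \<longlonglongrightarrow> 0"
    by (rule filterlim_compose[OF exp_at_bot])
  from tendsto_diff[OF size tendsto_mult_right[OF this, of r]]
  have "(\<lambda>n. exp (- S * \<tau> n) * real n) \<longlonglongrightarrow> x"
    by (simp add: algebra_simps)
  then have "(\<lambda>n. (exp (- S * \<tau> n) * real n) powr (m / S)) \<longlonglongrightarrow> x powr (m / S)"
    using \<open>0 < S\<close> \<open>0 < m\<close> by (intro tendsto_powr' tendsto_const) auto
  then have "(\<lambda>n. (exp (- S * \<tau> n) * real n) powr (m / S) * (real n powr (- (m / S)) * v n))
      \<longlonglongrightarrow> x powr (m / S) * wD"
    using wD by (rule tendsto_mult)
  moreover have "(exp (- S * \<tau> n) * real n) powr (m / S) * (real n powr (- (m / S)) * v n) =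
      exp (- m * \<tau> n) * v n" if "0 < n" for n
    using that \<open>0 < S\<close> by (simp add: powr_mult exp_powr_real powr_minus)
  ultimately show "(\<lambda>n. exp (- m * \<tau> n) * v n) \<longlonglongrightarrow> x powr (m / S) * wD"
    by (rule Lim_transform_eventually[OF _ eventually_mono[OF eventually_gt_at_top[of 0]]])
qed

section \<open>The balanced urn\<close>

lemma urn_exit_rate_Suc:
  assumes "a + b = S" and "c + d = S"
    and "exit_rate (urn_rate a b c d) s = r" and "urn_rate a b c d s z \<noteq> 0"
  shows "exit_rate (urn_rate a b c d) z = r + real S"
proof (cases s)
  case (Pair x y)
  with assms(4) have "z = (x + a, y + b) \<or> z = (x + c, y + d)"
    by (auto simp: urn_rate_def split: if_splits)
  with assms(1-3) Pair show ?thesis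
    by (auto simp: exit_rate_urn)
qed

lemma urn_laplace_product:
  assumes "0 < N" and "0 < S"
  shows "(\<lambda>n. \<Prod>k<n. (N + real k * S) / (N + real k * S + S)) \<longlonglongrightarrow> 0"
proof -
  have "(\<Prod>k<n. (N + real k * S) / (N + real k * S + S)) = N / (N + real n * S)" for n
  proof (induction n)
    case (Suc n)
    have "0 < N + real n * S"
      using assms by (intro add_pos_nonneg) auto
    moreover from this have "0 < N + real n * S + S"
      using assms by linarith
    ultimately have "N / (N + real n * S) * ((N + real n * S) / (N + real n * S + S)) =
        N / (N + real n * S + S)"
      by simp
    with Suc show ?case by (simp add: ring_distribs add_ac)
  qed (use assms in simp)
  moreover have "(\<lambda>n. N / (N + real n * S)) \<longlonglongrightarrow> 0"
    using assms(2) by (intro tendsto_divide_0[OF tendsto_const] filterlim_at_top_imp_at_infinity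
        filterlim_tendsto_add_at_top[OF tendsto_const]
        filterlim_at_top_mult_tendsto_pos[OF tendsto_const _ filterlim_real_sequentially])
  ultimately show ?thesis by simp
qed

theorem theorem3p10:
  fixes m S b a c d \<alpha> \<beta> :: nat
    and \<sigma> :: real
    and M :: "'w measure"
    and UCT :: "real \<Rightarrow> 'w \<Rightarrow> nat \<times> nat"
    and UDT :: "nat \<Rightarrow> 'w \<Rightarrow> nat \<times> nat"
    and \<tau> :: "nat \<Rightarrow> 'w \<Rightarrow> real"
    and \<xi> WCT WDT :: "'w \<Rightarrow> real"
  assumes "m + 2 \<le> S" and "S \<le> 2 * m - 1" and "1 \<le> b" and "b \<le> S - m - 1"
    and "a = S - b" and "c = S - m - b" and "d = m + b" and "\<sigma> = real m / real S"
    and "(\<alpha>, \<beta>) \<noteq> (0, 0)"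
    and "markov_jump_process M (urn_rate a b c d) (\<alpha>, \<beta>) UCT"
    and "\<forall>\<omega>\<in>space M. jump_times (\<lambda>t. UCT t \<omega>) (\<lambda>n. \<tau> n \<omega>)"
    and "\<forall>n. \<forall>\<omega>\<in>space M. UDT n \<omega> = UCT (\<tau> n \<omega>) \<omega>"
    and "\<xi> \<in> borel_measurable M" and "WCT \<in> borel_measurable M" and "WDT \<in> borel_measurable M"
    and "AE \<omega> in M. ((\<lambda>t. exp (- real S * t) * u1 S (UCT t \<omega>)) \<longlongrightarrow> \<xi> \<omega>) at_top"
    and "AE \<omega> in M. ((\<lambda>t. exp (- real m * t) * u2 S b c (UCT t \<omega>)) \<longlongrightarrow> WCT \<omega>) at_top"
    and "AE \<omega> in M. (\<lambda>n. real n powr (- \<sigma>) * u2 S b c (UDT n \<omega>)) \<longlonglongrightarrow> WDT \<omega>"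
  shows "(AE \<omega> in M. WCT \<omega> = \<xi> \<omega> powr \<sigma> * WDT \<omega>) \<and>
         prob_space.indep_var M borel \<xi> borel WDT"
proof -
  define N where "N = real \<alpha> + real \<beta>"
  define \<rho> where "\<rho> n = N + real n * real S" for n
  define V where "V n \<omega> = UCT (\<tau> n \<omega>) \<omega>" for n \<omega>
  define W where "W n \<omega> = \<tau> (Suc n) \<omega> - \<tau> n \<omega>" for n \<omega>
  have S: "0 < real S" and m: "0 < real m" and N: "0 < N"
    using assms(1,2,9) by (auto simp: N_def)
  have \<rho>_pos: "0 < \<rho> n" for n
    using N by (simp add: \<rho>_def add_pos_nonneg)
  have row_sums: "a + b = S" "c + d = S"
    using assms(1-7) by auto
  have jumps: "jump_times (\<lambda>t. UCT t \<omega>) (\<lambda>n. \<tau> n \<omega>)" if "\<omega> \<in> space M" for \<omega>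
    using assms(11) that by blast
  have rate_0: "exit_rate (urn_rate a b c d) (\<alpha>, \<beta>) = \<rho> 0"
    by (simp add: exit_rate_urn \<rho>_def N_def)
  have rate_Suc: "exit_rate (urn_rate a b c d) z = \<rho> (Suc n)"
    if "exit_rate (urn_rate a b c d) s = \<rho> n" "urn_rate a b c d s z \<noteq> 0" for n s z
    using urn_exit_rate_Suc[OF row_sums that] by (simp add: \<rho>_def algebra_simps)
  interpret clocked_chain M V W \<rho>
    unfolding V_def W_def
    by (rule clocked_chain_jump_process[OF assms(10) jumps \<rho>_pos rate_0 rate_Suc])
  have "AE \<omega> in M. exit_rate (urn_rate a b c d) (V n \<omega>) = \<rho> n" for n
    unfolding V_def by (rule AE_exit_rate_jump_process[OF assms(10) jumps \<rho>_pos rate_0 rate_Suc])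
  then have "AE \<omega> in M. \<forall>n. exit_rate (urn_rate a b c d) (V n \<omega>) = \<rho> n"
    by (simp add: AE_all_countable)
  then have size: "AE \<omega> in M. \<forall>n. u1 S (V n \<omega>) = real n + N / real S"
  proof eventually_elim
    case (elim \<omega>)
    show ?case
    proof
      fix n
      show "u1 S (V n \<omega>) = real n + N / real S"
        using elim[rule_format, of n] S
        by (cases "V n \<omega>") (simp add: exit_rate_urn u1_def \<rho>_def field_simps)
    qed
  qed
  have sum_W: "(\<Sum>k<n. W k \<omega>) = \<tau> n \<omega>" if "\<omega> \<in> space M" for n \<omega>
    using jumps[OF that] by (simp add: W_def sum_lessThan_telescope[of "\<lambda>k. \<tau> k \<omega>"] jump_times_def)
  have "AE \<omega> in M. filterlim (\<lambda>n. \<Sum>k<n. W k \<omega>) at_top sequentially"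
    using urn_laplace_product[OF N S] by (intro AE_clocks_diverge[OF S]) (simp add: \<rho>_def)
  with AE_space have explosion: "AE \<omega> in M. filterlim (\<lambda>n. \<tau> n \<omega>) at_top sequentially"
    by eventually_elim (simp add: sum_W)
  define X where "X \<omega> = lim (\<lambda>n. exp (- real S * (\<Sum>k<n. W k \<omega>)) * (real n + N / real S))" for \<omega>
  define Y where "Y \<omega> = lim (\<lambda>n. real n powr (- \<sigma>) * u2 S b c (V n \<omega>))" for \<omega>
  have \<xi>_lim: "AE \<omega> in M. (\<lambda>n. exp (- real S * \<tau> n \<omega>) * (real n + N / real S)) \<longlonglongrightarrow> \<xi> \<omega>"
    using assms(16) explosion size
  proof eventually_elim
    case (elim \<omega>)
    then show ?case
      using filterlim_compose[OF elim(1) elim(2)] by (simp add: V_def)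
  qed
  have X_eq: "AE \<omega> in M. X \<omega> = \<xi> \<omega>"
    using AE_space \<xi>_lim by eventually_elim (auto simp: X_def sum_W intro: limI)
  have Y_eq: "AE \<omega> in M. Y \<omega> = WDT \<omega>"
    using AE_space assms(18) by eventually_elim (use assms(12) in \<open>auto simp: Y_def V_def intro: limI\<close>)
  have "indep_var borel X borel Y"
  proof (rule indep_clocks_chain)
    show "X \<in> borel_measurable clock_algebra"
      unfolding X_def by measurable
    have [measurable]: "(\<lambda>\<omega>. u2 S b c (V n \<omega>)) \<in> borel_measurable chain_algebra" for n
      by (rule measurable_compose[OF chain_measurable_chain_algebra]) simp
    show "Y \<in> borel_measurable chain_algebra"
      unfolding Y_def by measurable
  qed
  then have "indep_var borel \<xi> borel WDT"
    using X_eq Y_eq assms(13,15) by (rule indep_var_cong_AE)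
  moreover have "AE \<omega> in M. WCT \<omega> = \<xi> \<omega> powr \<sigma> * WDT \<omega>"
    using AE_space \<xi>_lim explosion assms(17,18)
  proof eventually_elim
    case (elim \<omega>)
    have "(\<lambda>n. exp (- real m * \<tau> n \<omega>) * u2 S b c (UDT n \<omega>)) \<longlonglongrightarrow> WCT \<omega>"
      using filterlim_compose[OF elim(4) elim(3)] assms(12) elim(1) by simp
    then show ?case
      unfolding assms(8) using elim(5) assms(8)
      by (intro time_change_limit[OF elim(3) S m elim(2)]) auto
  qed
  ultimately show ?thesis by blast
qed

end
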